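(* Let $X$ be a Banach space and let $S=(X;X_k,k\geqslant 1)$ be a representing system of subspaces in $X$. If a system of closed linear subspaces $\widetilde{S}=(X;\widetilde{X}_k,k\geqslant 1)$ of $X$ satisfies $$\sum_{k=1}^{\infty}\rho_0(X_k,\widetilde{X}_k)<(2\overline{\Theta}_S)^{-1},$$ then $\widetilde{S}$ is a representing system of subspaces in $X$.
   Context: $X$ is a Banach space over $\mathbb{K}$ ($=\mathbb{R}$ or $\mathbb{C}$). A system $S=(X;X_k,k\geqslant 1)$ of closed linear subspaces of $X$ is a representing system of subspaces in $X$ if every $x\in X$ can be written as a norm-convergent series $x=\sum_{k=1}^\infty x_k$ with $x_k\in X_k$, $k\geqslant 1$. For closed subspaces $Y,Z$ of $X$, $\rho_0(Y,Z)=\sup\{d(y,Z): y\in Y,\ \|y\|=1\}$, where $d(y,Z)$ is the distance from $y$ to $Z$ (the value is $0$ if $Y=\{0\}$). For a finite tuple $P=(x_1,\ldots,x_n)$ with $x_k\in X_k$, $1\leqslant k\leqslant n$ ($n\geqslant 1$ arbitrary), put $\Sigma(P)=\sum_{k=1}^n x_k$ and $\Theta_S(P)=\max_{1\leqslant k\leqslant n}\bigl\|\sum_{j=1}^k x_j\bigr\|$. For $x\in X$, $\varepsilon>0$ put $\Theta_S(x,\varepsilon)=\inf\{\Theta_S(P): \|\Sigma(P)-x\|\leqslant\varepsilon\}$ (infimum over all such finite tuples $P$, with $\inf\varnothing=\infty$). For $x\in X$ put $\Theta_S^*(x)=\sup\{\Theta_S(x,\varepsilon):\varepsilon>0\}=\lim_{\varepsilon\to0+}\Theta_S(x,\varepsilon)$.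 Finally, $\overline{\Theta}_S=\sup\{\Theta_S^*(x):\|x\|\leqslant 1\}$. *)

theory Defs
  imports "HOL-Analysis.Analysis"
begin

(* Banach spaces over K. Isabelle/HOL only has the class of real Banach spaces, so the K-linear
   structure is an explicit scalar multiplication extending the real one. The scalars range over
   the class real_normed_field (with multiplicative norm); by Gelfand-Mazur its members are, up to
   isometric isomorphism, exactly the reals and the complex numbers. *)
locale banach_space_over = vector_space scl
  for scl :: "'k::real_normed_field \<Rightarrow> 'a::banach \<Rightarrow> 'a" +
  assumes norm_scale: "norm (scl c x) = norm c * norm x"
    and scale_of_real: "scl (of_real r) x = r *\<^sub>R x"

lemma banach_space_over_real:
  "banach_space_over (scaleR :: real \<Rightarrow> 'a::banach \<Rightarrow> 'a)"
  by unfold_locales (auto simp: algebra_simps)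

lemma banach_space_over_complex:
  "banach_space_over ((*) :: complex \<Rightarrow> complex \<Rightarrow> complex)"
  by unfold_locales (auto simp: algebra_simps norm_mult scaleR_conv_of_real)

(* Sequences of subspaces are indexed from 0, so X k stands for the (k+1)-st subspace. *)
definition closed_subspace_system ::
  "('k::real_normed_field \<Rightarrow> 'a::banach \<Rightarrow> 'a) \<Rightarrow> (nat \<Rightarrow> 'a set) \<Rightarrow> bool" where
  "closed_subspace_system scl X \<longleftrightarrow> (\<forall>k. module.subspace scl (X k) \<and> closed (X k))"

definition representing_system ::
  "('k::real_normed_field \<Rightarrow> 'a::banach \<Rightarrow> 'a) \<Rightarrow> (nat \<Rightarrow> 'a set) \<Rightarrow> bool" where
  "representing_system scl X \<longleftrightarrow>
     closed_subspace_system scl X \<and> (\<forall>x. \<exists>f. (\<forall>k. f k \<in> X k) \<and> f sums x)"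

(* In ennreal the supremum of the empty set is 0, as required for Y = {0}. *)
definition rho0 :: "'a::real_normed_vector set \<Rightarrow> 'a set \<Rightarrow> ennreal" where
  "rho0 Y Z = (SUP y\<in>{y \<in> Y. norm y = 1}. ennreal (infdist y Z))"

definition system_tuples :: "(nat \<Rightarrow> 'a set) \<Rightarrow> 'a list set" where
  "system_tuples X = {P. P \<noteq> [] \<and> (\<forall>k < length P. P ! k \<in> X k)}"

definition Theta_tuple :: "'a::real_normed_vector list \<Rightarrow> real" where
  "Theta_tuple P = (MAX k\<in>{1..length P}. norm (sum_list (take k P)))"

definition Theta_eps :: "(nat \<Rightarrow> 'a::real_normed_vector set) \<Rightarrow> 'a \<Rightarrow> real \<Rightarrow> ennreal" where
  "Theta_eps X x \<epsilon> =
     (INF P\<in>{P \<in> system_tuples X. norm (sum_list P - x) \<le> \<epsilon>}. ennreal (Theta_tuple P))"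

definition Theta_star :: "(nat \<Rightarrow> 'a::real_normed_vector set) \<Rightarrow> 'a \<Rightarrow> ennreal" where
  "Theta_star X x = (SUP \<epsilon>\<in>{0<..}. Theta_eps X x \<epsilon>)"

definition Theta_bar :: "(nat \<Rightarrow> 'a::real_normed_vector set) \<Rightarrow> ennreal" where
  "Theta_bar X = (SUP x\<in>{x. norm x \<le> 1}. Theta_star X x)"

end

theory Submission
  imports Defs
begin

text \<open>
  The argument is a successive approximation. Put \<open>\<delta> = (\<Sum>k. rho0 (X k) (X' k))\<close> and choose a
  real number \<open>M > Theta_bar X\<close> with \<open>2 * M * \<delta> < 1\<close>. A vector \<open>x\<close> of the unit ball is
  approximated arbitrarily well by the sum of a finite tuple with entries in the subspaces \<open>X k\<close>
  and partial sums of norm at most \<open>M\<close>. An entry is a difference of two partial sums, so its norm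
  is at most \<open>2 * M\<close>; moving the \<open>k\<close>-th entry into \<open>X' k\<close> therefore costs not much more than
  \<open>2 * M * rho0 (X k) (X' k)\<close>. In total the moved tuple has bounded partial sums, and its sum
  differs from \<open>x\<close> by at most a fixed \<open>q < 1\<close> (\<open>approximation_in_perturbed_system\<close>).

  By homogeneity this holds for every \<open>x\<close>, with error \<open>q * norm x\<close>. Applying it again to the
  remainder, and so on, yields expansions \<open>g j\<close> whose sums add up to \<open>x\<close> and whose partial sums
  decay like \<open>q ^ j\<close>, uniformly in the length of the partial sum. Adding them entry by entry gives
  \<open>f k = (\<Sum>j. g j k)\<close>, which lies in \<open>X' k\<close> because \<open>X' k\<close> is closed, and the uniform decay
  permits the two limits to be interchanged, so that \<open>f sums x\<close>
  (\<open>expansion_of_approximate_expansions\<close>).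
\<close>

section \<open>Closed subspaces\<close>

lemma real_subspace_of_subspace:
  assumes "banach_space_over scl" "module.subspace scl Y"
  shows "subspace Y"
proof -
  interpret S: banach_space_over scl by fact
  show ?thesis
    unfolding subspace_def
    using assms(2) S.subspace_0 S.subspace_add S.subspace_scale[of Y _ "of_real _"]
    by (auto simp: S.scale_of_real)
qed

lemma closed_subspace_suminf:
  fixes g :: "nat \<Rightarrow> 'a::real_normed_vector"
  assumes "closed Y" "subspace Y" "\<And>j. g j \<in> Y" "summable g"
  shows "suminf g \<in> Y"
proof (rule closed_sequentially)
  show "closed Y" by fact
  show "(\<Sum>j<n. g j) \<in> Y" for n
    using assms by (auto intro: subspace_sum)
  show "(\<lambda>n. \<Sum>j<n. g j) \<longlonglongrightarrow> suminf g"
    using assms(4) by (rule summable_LIMSEQ)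
qed

section \<open>Exact expansions from approximate ones\<close>

text \<open>
  The iteration. The vector \<open>G x\<close> below is an approximate expansion of \<open>x\<close>, with sum \<open>s x\<close>, and
  \<open>r j\<close> is the remainder after \<open>j\<close> steps. All expansions start at index 0, so they are added entry
  by entry rather than concatenated.
\<close>

lemma expansion_of_approximate_expansions:
  fixes Y :: "nat \<Rightarrow> 'a::banach set"
  assumes closed: "\<And>k. closed (Y k)" and subspace: "\<And>k. subspace (Y k)"
    and q: "0 \<le> q" "q < 1"
    and approx: "\<And>x. \<exists>g s. (\<forall>k. g k \<in> Y k) \<and> g sums s \<and>
                   (\<forall>n. norm (\<Sum>k<n. g k) \<le> C * norm x) \<and> norm (x - s) \<le> q * norm x"
  shows "\<exists>f. (\<forall>k. f k \<in> Y k) \<and> f sums x"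
proof -
  obtain G s where G: "\<And>x k. G x k \<in> Y k" "\<And>x. G x sums s x"
    "\<And>x n. norm (\<Sum>k<n. G x k) \<le> C * norm x" "\<And>x. norm (x - s x) \<le> q * norm x"
    using approx by metis
  define r where "r = rec_nat x (\<lambda>_ y. y - s y)"
  have r0 [simp]: "r 0 = x" and rSuc: "\<And>j. r (Suc j) = r j - s (r j)"
    by (simp_all add: r_def)
  have r_norm: "norm (r j) \<le> q ^ j * norm x" for j
  proof (induction j)
    case (Suc j)
    have "norm (r (Suc j)) \<le> q * norm (r j)"
      using G(4) by (simp add: rSuc)
    also have "\<dots> \<le> q * (q ^ j * norm x)"
      using Suc q by (intro mult_left_mono)
    finally show ?case by (simp add: mult.assoc)
  qed simp
  have C: "C * norm z \<ge> 0" for z :: 'a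
    using G(3)[of z 0] by simp
  define K where "K = C * norm x"
  have K: "C * norm (r j) \<le> K * q ^ j" for j
  proof (cases "C \<ge> 0")
    case True
    then have "C * norm (r j) \<le> C * (q ^ j * norm x)"
      using r_norm by (intro mult_left_mono) auto
    then show ?thesis by (simp add: K_def mult_ac)
  next
    case False
    then have "norm (r j) = 0" using C[of "r j"] by (simp add: zero_le_mult_iff)
    moreover have "K \<ge> 0" using C by (simp add: K_def)
    ultimately show ?thesis using q by simp
  qed
  have sumK: "summable (\<lambda>j. c * q ^ j)" for c :: real
    using q by (intro summable_mult summable_geometric) auto
  define a where "a j n = (\<Sum>k<n. G (r j) k)" for j n
  have a_bound: "norm (a j n) \<le> K * q ^ j" for j n
    unfolding a_def using G(3)[of "r j" n] K[of j] by linarith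
  have G_bound: "norm (G (r j) k) \<le> (2 * K) * q ^ j" for j k
  proof -
    have "G (r j) k = a j (Suc k) - a j k" by (simp add: a_def)
    then have "norm (G (r j) k) \<le> norm (a j (Suc k)) + norm (a j k)"
      by (simp add: norm_triangle_ineq4)
    then show ?thesis using a_bound[of j k] a_bound[of j "Suc k"] by simp
  qed
  have G_summable: "summable (\<lambda>j. G (r j) k)" for k
    using G_bound by (intro summable_comparison_test'[OF sumK[of "2 * K"]]) auto
  define f where "f k = (\<Sum>j. G (r j) k)" for k
  have "f k \<in> Y k" for k
    unfolding f_def using closed subspace G(1) G_summable by (rule closed_subspace_suminf)
  moreover have "f sums x"
  proof -
    have uniform: "uniform_limit UNIV (\<lambda>m n. \<Sum>j<m. a j n) (\<lambda>n. \<Sum>j. a j n) sequentially"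
      using a_bound sumK[of K] by (intro Weierstrass_m_test)
    have inner: "(\<lambda>n. \<Sum>j<m. a j n) \<longlonglongrightarrow> (\<Sum>j<m. s (r j))" for m
      unfolding a_def by (intro tendsto_sum) (use G(2) in \<open>simp add: sums_def\<close>)
    have "r \<longlonglongrightarrow> 0"
    proof (rule Lim_null_comparison)
      show "\<forall>\<^sub>F j in sequentially. norm (r j) \<le> norm x * q ^ j"
        using r_norm by (simp add: mult.commute)
      show "(\<lambda>j. norm x * q ^ j) \<longlonglongrightarrow> 0"
        using sumK by (rule summable_LIMSEQ_zero)
    qed
    then have "(\<lambda>j. s (r j)) sums x"
      using telescope_sums'[of r 0] by (simp add: rSuc)
    then have outer: "(\<lambda>m. \<Sum>j<m. s (r j)) \<longlonglongrightarrow> x"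
      by (simp add: sums_def)
    have "(\<lambda>n. \<Sum>j. a j n) \<longlonglongrightarrow> x"
      using inner by (intro swap_uniform_limit'[OF _ outer uniform]) auto
    moreover have "(\<Sum>j. a j n) = (\<Sum>k<n. f k)" for n
      unfolding a_def f_def by (intro suminf_sum G_summable)
    ultimately show ?thesis by (simp add: sums_def)
  qed
  ultimately show ?thesis by blast
qed

section \<open>Tuples with bounded partial sums and their perturbation\<close>

lemma norm_sum_list_take_le_Theta_tuple:
  assumes "P \<noteq> []"
  shows "norm (sum_list (take n P)) \<le> Theta_tuple P"
proof -
  have le: "norm (sum_list (take k P)) \<le> Theta_tuple P" if "k \<in> {1..length P}" for k
    unfolding Theta_tuple_def using that by (intro Max_ge) auto
  have len: "1 \<le> length P" using assms by (cases P) auto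
  consider "n = 0" | "n \<in> {1..length P}" | "n > length P" by force
  then show ?thesis
  proof cases
    case 1
    have "0 \<le> norm (sum_list (take 1 P))" by simp
    also have "\<dots> \<le> Theta_tuple P" using le len by simp
    finally show ?thesis using 1 by simp
  next
    case 2
    then show ?thesis by (rule le)
  next
    case 3
    then show ?thesis using le[of "length P"] len by simp
  qed
qed

lemma tuple_of_Theta_bar_less:
  assumes "Theta_bar X < ennreal M" "norm x \<le> 1" "\<epsilon> > 0"
  obtains P where "P \<in> system_tuples X" "norm (sum_list P - x) \<le> \<epsilon>" "Theta_tuple P < M"
proof -
  have "Theta_eps X x \<epsilon> \<le> Theta_star X x"
    unfolding Theta_star_def using assms(3) by (intro SUP_upper) auto
  also have "\<dots> \<le> Theta_bar X"
    unfolding Theta_bar_def using assms(2) by (intro SUP_upper) auto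
  finally have "Theta_eps X x \<epsilon> < ennreal M" using assms(1) by order
  then obtain P where P: "P \<in> system_tuples X" "norm (sum_list P - x) \<le> \<epsilon>"
    "ennreal (Theta_tuple P) < ennreal M"
    unfolding Theta_eps_def INF_less_iff by auto
  then have "Theta_tuple P < M"
    using norm_sum_list_take_le_Theta_tuple[of P 0] by (simp add: system_tuples_def ennreal_less_iff)
  with P show ?thesis by (intro that)
qed

text \<open>The infimum in the distance to \<open>Z\<close> need not be attained, hence the slack \<open>\<eta>\<close>.\<close>

lemma near_point_of_rho0:
  fixes Y Z :: "'a::real_normed_vector set"
  assumes "subspace Y" "subspace Z" "rho0 Y Z \<noteq> top" "y \<in> Y" "\<eta> > 0"
  obtains z where "z \<in> Z" "norm (y - z) \<le> (enn2real (rho0 Y Z) + \<eta>) * norm y"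
proof (cases "y = 0")
  case True
  with \<open>subspace Z\<close> show ?thesis by (intro that[of 0]) (auto simp: subspace_0)
next
  case False
  define u where "u = y /\<^sub>R norm y"
  have u: "u \<in> Y" "norm u = 1" "y = norm y *\<^sub>R u"
    using False assms(1,4) by (auto simp: u_def subspace_scale)
  have "ennreal (infdist u Z) \<le> rho0 Y Z"
    unfolding rho0_def using u by (intro SUP_upper) auto
  then have "infdist u Z \<le> enn2real (rho0 Y Z)"
    using assms(3) by (metis enn2real_ennreal enn2real_mono infdist_nonneg top.not_eq_extremum)
  then have less: "infdist u Z < enn2real (rho0 Y Z) + \<eta>" using \<open>\<eta> > 0\<close> by simp
  have "Z \<noteq> {}" using \<open>subspace Z\<close> subspace_0 by blast
  with less have "(INF w\<in>Z. dist u w) < enn2real (rho0 Y Z) + \<eta>"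
    by (simp add: infdist_def)
  then obtain w where w: "w \<in> Z" "dist u w < enn2real (rho0 Y Z) + \<eta>"
    using \<open>Z \<noteq> {}\<close> by (subst (asm) cINF_less_iff) auto
  have "norm (y - norm y *\<^sub>R w) = norm (norm y *\<^sub>R (u - w))"
    using u(3) by (simp add: scaleR_diff_right)
  also have "\<dots> = dist u w * norm y"
    by (simp add: dist_norm)
  also have "\<dots> \<le> (enn2real (rho0 Y Z) + \<eta>) * norm y"
    using w by (intro mult_right_mono) auto
  finally show ?thesis
    using w \<open>subspace Z\<close> by (intro that[of "norm y *\<^sub>R w"]) (auto simp: subspace_scale)
qed

lemma approximation_in_perturbed_system:
  fixes X Z :: "nat \<Rightarrow> 'a::real_normed_vector set"
  assumes X: "\<And>k. subspace (X k)" and Z: "\<And>k. subspace (Z k)"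
    and rho: "\<And>k. rho0 (X k) (Z k) \<noteq> top"
    and \<delta>: "\<And>n. (\<Sum>k<n. enn2real (rho0 (X k) (Z k))) \<le> \<delta>"
    and M: "Theta_bar X < ennreal M" "0 \<le> M"
    and x: "norm x \<le> 1" and \<epsilon>: "0 < \<epsilon>" and \<eta>: "0 < \<eta>"
  shows "\<exists>g s. (\<forall>k. g k \<in> Z k) \<and> g sums s \<and>
           (\<forall>n. norm (\<Sum>k<n. g k) \<le> M + 2 * M * (\<delta> + \<eta>)) \<and>
           norm (x - s) \<le> \<epsilon> + 2 * M * (\<delta> + \<eta>)"
proof -
  obtain P where P: "P \<in> system_tuples X" "norm (sum_list P - x) \<le> \<epsilon>" "Theta_tuple P < M"
    using tuple_of_Theta_bar_less[OF M(1) x \<epsilon>] .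
  have "P \<noteq> []" using P(1) by (simp add: system_tuples_def)
  define p where "p k = (if k < length P then P ! k else 0)" for k
  have p_in: "p k \<in> X k" for k
    using P(1) X by (auto simp: p_def system_tuples_def subspace_0)
  have p_sum: "(\<Sum>k<n. p k) = sum_list (take n P)" for n
  proof -
    have "(\<Sum>k<n. p k) = (\<Sum>k<min (length P) n. P ! k)"
      unfolding p_def by (intro sum.mono_neutral_cong_right) auto
    then show ?thesis by (simp add: sum_list_sum_nth atLeast0LessThan)
  qed
  have p_partial: "norm (\<Sum>k<n. p k) \<le> M" for n
    unfolding p_sum using norm_sum_list_take_le_Theta_tuple[OF \<open>P \<noteq> []\<close>, of n] P(3) by simp
  have p_norm: "norm (p k) \<le> 2 * M" for k
  proof -
    have "p k = (\<Sum>i<Suc k. p i) - (\<Sum>i<k. p i)" by simp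
    then have "norm (p k) \<le> norm (\<Sum>i<Suc k. p i) + norm (\<Sum>i<k. p i)"
      by (metis norm_triangle_ineq4)
    then show ?thesis using p_partial[of k] p_partial[of "Suc k"] by linarith
  qed
  \<comment> \<open>The slacks of the individual entries are chosen to add up to \<open>\<eta>\<close>.\<close>
  define d where "d k = enn2real (rho0 (X k) (Z k)) + \<eta> * (1 / 2) ^ Suc k" for k
  have d_nonneg: "0 \<le> d k" for k using \<eta> by (simp add: d_def)
  have d_sum: "(\<Sum>k<n. d k) \<le> \<delta> + \<eta>" for n
  proof -
    have "(\<Sum>k<n. (1 / 2 :: real) ^ Suc k) \<le> 1"
      using sum_le_suminf[OF sums_summable[OF power_half_series], of "{..<n}"]
        sums_unique[OF power_half_series] by simp
    then have "\<eta> * (\<Sum>k<n. (1 / 2) ^ Suc k) \<le> \<eta> * 1"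
      using \<eta> by (intro mult_left_mono) auto
    with \<delta>[of n] show ?thesis
      by (simp add: d_def sum.distrib sum_distrib_left)
  qed
  have "\<exists>z. z \<in> Z k \<and> norm (p k - z) \<le> d k * norm (p k)" for k
    using near_point_of_rho0[OF X Z rho p_in, of "\<eta> * (1 / 2) ^ Suc k"] \<eta> unfolding d_def
    by (metis half_gt_zero_iff mult_pos_pos zero_less_one zero_less_power)
  then obtain g where g_in: "\<And>k. g k \<in> Z k" and g_near: "\<And>k. norm (p k - g k) \<le> d k * norm (p k)"
    by metis
  have g_zero: "g k = 0" if "k \<notin> {..<length P}" for k
    using g_near[of k] that by (simp add: p_def)
  define s where "s = (\<Sum>k<length P. g k)"
  have "g sums s"
    unfolding s_def using g_zero by (intro sums_finite) auto
  have diff: "norm ((\<Sum>k<n. p k) - (\<Sum>k<n. g k)) \<le> 2 * M * (\<delta> + \<eta>)" for n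
  proof -
    have "norm ((\<Sum>k<n. p k) - (\<Sum>k<n. g k)) = norm (\<Sum>k<n. p k - g k)"
      by (simp add: sum_subtractf)
    also have "\<dots> \<le> (\<Sum>k<n. d k * (2 * M))"
      using g_near p_norm d_nonneg by (intro sum_norm_le) (meson mult_left_mono order_trans)
    also have "\<dots> = 2 * M * (\<Sum>k<n. d k)"
      by (simp add: sum_distrib_left mult_ac)
    also have "\<dots> \<le> 2 * M * (\<delta> + \<eta>)"
      using d_sum M by (intro mult_left_mono) auto
    finally show ?thesis .
  qed
  have "norm (\<Sum>k<n. g k) \<le> M + 2 * M * (\<delta> + \<eta>)" for n
    using diff[of n] p_partial[of n] norm_triangle_sub[of "\<Sum>k<n. g k" "\<Sum>k<n. p k"]
    by (simp add: norm_minus_commute)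
  moreover have "norm (x - s) \<le> \<epsilon> + 2 * M * (\<delta> + \<eta>)"
  proof -
    have "norm (x - s) \<le> norm (x - sum_list P) + norm (sum_list P - s)"
      using norm_triangle_ineq[of "x - sum_list P" "sum_list P - s"] by simp
    then show ?thesis
      using P(2) diff[of "length P"] by (simp add: p_sum s_def norm_minus_commute)
  qed
  ultimately show ?thesis using g_in \<open>g sums s\<close> by blast
qed

section \<open>Stability of representing systems\<close>

theorem mainTheorem5:
  fixes scl :: "'k::real_normed_field \<Rightarrow> 'a::banach \<Rightarrow> 'a"
    and X X' :: "nat \<Rightarrow> 'a set"
  assumes "banach_space_over scl"
    and "representing_system scl X"
    and "closed_subspace_system scl X'"
    and "(\<Sum>k. rho0 (X k) (X' k)) < inverse (2 * Theta_bar X)"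
  shows "representing_system scl X'"
proof -
  have X: "subspace (X k)" for k
    using assms(2) by (auto simp: representing_system_def closed_subspace_system_def intro: real_subspace_of_subspace[OF assms(1)])
  have X': "subspace (X' k)" "closed (X' k)" for k
    using assms(3) by (auto simp: closed_subspace_system_def intro: real_subspace_of_subspace[OF assms(1)])
  define D where "D = (\<Sum>k. rho0 (X k) (X' k))"
  define \<delta> where "\<delta> = enn2real D"
  have "D < top" using assms(4) unfolding D_def by (metis order_less_le_trans top_greatest)
  then have D: "D = ennreal \<delta>" by (simp add: \<delta>_def)
  have \<delta>: "0 \<le> \<delta>" by (simp add: \<delta>_def)
  have partial: "(\<Sum>k<n. rho0 (X k) (X' k)) \<le> D" for n
    unfolding D_def by (intro sum_le_suminf) auto
  have rho: "rho0 (X k) (X' k) \<noteq> top" for k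
  proof -
    have "rho0 (X k) (X' k) \<le> (\<Sum>k<Suc k. rho0 (X k) (X' k))" by simp
    also have "\<dots> < top" using partial \<open>D < top\<close> order_le_less_trans by blast
    finally show ?thesis by simp
  qed
  have rho_sum: "(\<Sum>k<n. enn2real (rho0 (X k) (X' k))) \<le> \<delta>" for n
  proof -
    have "(\<Sum>k<n. enn2real (rho0 (X k) (X' k))) = enn2real (\<Sum>k<n. rho0 (X k) (X' k))"
      using rho by (subst enn2real_sum) (auto simp: top.not_eq_extremum)
    also have "\<dots> \<le> \<delta>"
      unfolding \<delta>_def using partial \<open>D < top\<close> by (rule enn2real_mono)
    finally show ?thesis .
  qed
  define T where "T = enn2real (Theta_bar X)"
  have "Theta_bar X \<noteq> top"
    using assms(4) by (auto simp: ennreal_mult_top)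
  then have T: "Theta_bar X = ennreal T" "0 \<le> T" by (simp_all add: T_def top.not_eq_extremum)
  \<comment> \<open>If \<open>T = 0\<close> then \<open>inverse (2 * Theta_bar X)\<close> is infinite, so this case is separate.\<close>
  have T\<delta>: "2 * T * \<delta> < 1"
  proof (cases "T = 0")
    case False
    then have "T > 0" using T by simp
    have "2 * Theta_bar X = ennreal (2 * T)"
      using T by (simp add: ennreal_mult')
    then have "ennreal \<delta> < ennreal (inverse (2 * T))"
      using assms(4) \<open>T > 0\<close> by (simp add: D_def[symmetric] D inverse_ennreal)
    then show ?thesis
      using \<delta> \<open>T > 0\<close> by (simp add: ennreal_less_iff field_simps)
  qed simp
  \<comment> \<open>With this \<open>M\<close> the product \<open>2 * M * \<delta>\<close> exceeds \<open>2 * T * \<delta>\<close> by at most half of the gap to 1.\<close>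
  define M where "M = T + (1 - 2 * T * \<delta>) / (4 * (\<delta> + 1))"
  have "M > T" using T\<delta> \<delta> by (simp add: M_def)
  then have M: "Theta_bar X < ennreal M" "0 < M"
    using T by (auto simp: ennreal_less_iff)
  have M\<delta>: "2 * M * \<delta> < 1"
  proof -
    have "2 * M * \<delta> = 2 * T * \<delta> + (1 - 2 * T * \<delta>) / 2 * (\<delta> / (\<delta> + 1))"
      using \<delta> by (simp add: M_def field_simps)
    also have "\<dots> \<le> 2 * T * \<delta> + (1 - 2 * T * \<delta>) / 2 * 1"
      using T\<delta> \<delta> by (intro add_left_mono mult_left_mono) auto
    also have "\<dots> < 1" using T\<delta> by (simp add: field_simps)
    finally show ?thesis .
  qed
  define \<epsilon> where "\<epsilon> = (1 - 2 * M * \<delta>) / 3"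
  define \<eta> where "\<eta> = \<epsilon> / (2 * M)"
  have \<epsilon>: "0 < \<epsilon>" and \<eta>: "0 < \<eta>" using M M\<delta> by (simp_all add: \<epsilon>_def \<eta>_def)
  define q where "q = \<epsilon> + 2 * M * (\<delta> + \<eta>)"
  define C where "C = M + 2 * M * (\<delta> + \<eta>)"
  have "2 * M * \<eta> = \<epsilon>" using M by (simp add: \<eta>_def)
  then have "q = 1 - \<epsilon>" by (simp add: q_def \<epsilon>_def algebra_simps)
  then have "q < 1" using \<epsilon> by simp
  have "0 \<le> q" using \<epsilon> \<eta> \<delta> M by (simp add: q_def)
  have approx: "\<exists>g s. (\<forall>k. g k \<in> X' k) \<and> g sums s \<and>
                  (\<forall>n. norm (\<Sum>k<n. g k) \<le> C * norm x) \<and> norm (x - s) \<le> q * norm x" for x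
  proof (cases "x = 0")
    case True
    then show ?thesis
      using X' by (intro exI[of _ "\<lambda>_. 0"] exI[of _ 0]) (auto simp: subspace_0)
  next
    case False
    define u where "u = x /\<^sub>R norm x"
    have x: "x = norm x *\<^sub>R u" and "norm u \<le> 1" using False by (auto simp: u_def)
    obtain g s where g: "\<And>k. g k \<in> X' k" "g sums s" "\<And>n. norm (\<Sum>k<n. g k) \<le> C"
      "norm (u - s) \<le> q"
      using approximation_in_perturbed_system[of X X', OF X X'(1) rho rho_sum M(1) less_imp_le[OF M(2)]
          \<open>norm u \<le> 1\<close> \<epsilon> \<eta>] unfolding C_def q_def by blast
    have "norm (\<Sum>k<n. norm x *\<^sub>R g k) \<le> C * norm x" for n
      using mult_left_mono[OF g(3), of "norm x"]
      by (simp add: scaleR_sum_right[symmetric] mult.commute)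
    moreover have "norm (x - norm x *\<^sub>R s) \<le> q * norm x"
    proof -
      have "x - norm x *\<^sub>R s = norm x *\<^sub>R (u - s)"
        using x by (simp add: scaleR_diff_right)
      then show ?thesis
        using mult_left_mono[OF g(4), of "norm x"] by (simp add: mult.commute)
    qed
    moreover have "(\<lambda>k. norm x *\<^sub>R g k) sums (norm x *\<^sub>R s)"
      using g(2) by (rule sums_scaleR_right)
    moreover have "norm x *\<^sub>R g k \<in> X' k" for k
      using g(1) X'(1) by (simp add: subspace_scale)
    ultimately show ?thesis
      by (intro exI[of _ "\<lambda>k. norm x *\<^sub>R g k"] exI[of _ "norm x *\<^sub>R s"] conjI allI)
  qed
  have "\<exists>f. (\<forall>k. f k \<in> X' k) \<and> f sums x" for x
    by (rule expansion_of_approximate_expansions[OF X'(2) X'(1) \<open>0 \<le> q\<close> \<open>q < 1\<close> approx])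
  then show ?thesis
    using assms(3) by (simp add: representing_system_def)
qed

end
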